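(* Let $p$ be a prime, $q$ a power of $p$, $e\ge 2$, and let $a,b$ be integers with $0<b<a<pe$. Then $g_{q^a-q^b-1,q}\equiv -x^{q^e-2}\pmod{x^{q^e}-x}$ if and only if $a\equiv b\equiv 0\pmod e$. In particular, if $0<b<a<pe$ and $a\equiv b\equiv 0\pmod e$, then $g_{q^a-q^b-1,q}$ is a permutation polynomial of $\mathbb{F}_{q^e}$.
   Context: For a prime $p$, a power $q$ of $p$ and an integer $n\ge 0$, $g_{n,q}\in\mathbb{F}_p[x]$ is the unique polynomial with $\sum_{a\in\mathbb{F}_q}(x+a)^n=g_{n,q}(x^q-x)$. A permutation polynomial of a finite field $\mathbb{F}$ is a polynomial inducing a bijection of $\mathbb{F}$. *)

theory Defs
  imports
    "HOL-Algebra.Algebraic_Closure_Type"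
    "Berlekamp_Zassenhaus.Finite_Field"
begin

text \<open>
  The prime field of order \<open>p = CARD('p)\<close> is \<open>'p mod_ring\<close> with \<open>'p :: prime_card\<close>. All finite fields
  of characteristic \<open>p\<close> are realised inside its algebraic closure: for \<open>q\<close> a positive power of \<open>p\<close>,
  the field with \<open>q\<close> elements is the set of solutions of \<open>x ^ q = x\<close>. This keeps \<open>q\<close> and the
  extension degree ordinary numbers instead of types. The set is only meaningful for such \<open>q\<close>;
  see \<open>GF_subfield\<close> and \<open>card_GF\<close> below.
\<close>

definition GF :: "nat \<Rightarrow> 'p :: prime_card mod_ring alg_closure set" where
  "GF q = {x. x ^ q = x}"

definition permutation_poly_on :: "'p :: prime_card mod_ring alg_closure set \<Rightarrow> 'p mod_ring poly \<Rightarrow> bool"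
  where "permutation_poly_on F f \<longleftrightarrow> bij_betw (poly (map_poly to_ac f)) F F"

text \<open>
  The polynomial \<open>g\<close> has coefficients in the prime field; its defining identity is an identity of
  polynomials over the algebraic closure, where \<open>[:a, 1:]\<close> is \<open>x + a\<close>. That there is exactly one
  such \<open>g\<close> is \<open>g_poly_ex1\<close> below.
\<close>

definition g_poly :: "nat \<Rightarrow> nat \<Rightarrow> 'p :: prime_card mod_ring poly" where
  "g_poly n q = (THE g. (\<Sum>a\<in>GF q. [:a, 1:] ^ n) = map_poly to_ac g \<circ>\<^sub>p (monom 1 q - monom 1 1))"


lemma CHAR_closure: "CHAR('p :: prime_card mod_ring alg_closure) = CARD('p)"
  by simp

lemma frobenius_add:
  fixes x y :: "'p :: prime_card mod_ring alg_closure"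
  assumes "q = CARD('p) ^ k"
  shows "(x + y) ^ q = x ^ q + y ^ q"
  by (rule freshmans_dream'[where n = k]) (simp_all add: assms prime_card)

lemma frobenius_poly_add:
  fixes x y :: "'p :: prime_card mod_ring alg_closure poly"
  assumes "q = CARD('p) ^ k"
  shows "(x + y) ^ q = x ^ q + y ^ q"
  by (rule freshmans_dream'[where n = k]) (simp_all add: assms prime_card)

lemma frobenius_sum:
  fixes f :: "'b \<Rightarrow> 'p :: prime_card mod_ring alg_closure"
  assumes "q = CARD('p) ^ k"
  shows "sum f A ^ q = (\<Sum>i\<in>A. f i ^ q)"
  by (rule freshmans_dream_sum'[where n = k]) (simp_all add: assms prime_card)

lemma card_p_gt_1: "CARD('p :: prime_card) > 1"
  using prime_card prime_gt_1_nat by blast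

lemma GF_subfield:
  fixes x y :: "'p :: prime_card mod_ring alg_closure"
  assumes "q = CARD('p) ^ k" "x \<in> GF q" "y \<in> GF q"
  shows "0 \<in> GF q" "1 \<in> GF q" "x + y \<in> GF q" "- x \<in> GF q" "x * y \<in> GF q" "inverse x \<in> GF q"
proof -
  have q0: "q > 0"
    using assms(1) by simp
  show "0 \<in> GF q" "1 \<in> GF q" "x * y \<in> GF q" "inverse x \<in> GF q"
    using assms q0 by (simp_all add: GF_def power_mult_distrib power_inverse)
  show "x + y \<in> GF q"
    using assms frobenius_add[OF assms(1), of x y] by (simp add: GF_def)
  have "x ^ q + (- x) ^ q = 0"
    using frobenius_add[OF assms(1), of x "- x"] q0 by (simp add: power_0_left)
  thus "- x \<in> GF q"
    using assms by (simp add: GF_def add_eq_0_iff)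
qed

lemma card_GF:
  assumes "q = CARD('p :: prime_card) ^ k" "k > 0"
  shows "card (GF q :: 'p mod_ring alg_closure set) = q"
proof -
  define P :: "'p mod_ring alg_closure poly" where "P = monom 1 q - monom 1 1"
  have q1: "q > 1"
    unfolding assms(1) by (rule one_less_power[OF card_p_gt_1 assms(2)])
  have deg: "degree P = q" "lead_coeff P = 1"
  proof -
    have "degree P = degree (monom 1 q :: 'p mod_ring alg_closure poly)"
      unfolding P_def diff_conv_add_uminus
      by (rule degree_add_eq_left) (use q1 in \<open>simp add: degree_monom_eq\<close>)
    thus "degree P = q"
      by (simp add: degree_monom_eq)
    thus "lead_coeff P = 1"
      using q1 by (simp add: P_def)
  qed
  hence "P \<noteq> 0"
    using q1 by auto
  then obtain A where A: "size A = q" "P = (\<Prod>x\<in>#A. [:- x, 1:])"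
    using alg_closed_imp_factorization[of P] deg by auto
  have "of_nat q = (0 :: 'p mod_ring alg_closure)"
    unfolding of_nat_eq_0_iff_char_dvd using assms by simp
  hence dP: "pderiv P = - 1"
    by (simp add: P_def pderiv_diff pderiv_monom)
  have count: "count A x \<le> 1" for x
  proof (rule ccontr)
    assume "\<not> count A x \<le> 1"
    hence "{#x, x#} \<subseteq># A"
      by (intro mset_subset_eqI) auto
    then obtain B where "A = {#x, x#} + B"
      by (auto simp: mset_subset_eq_exists_conv)
    hence P: "P = [:- x, 1:] * ([:- x, 1:] * (\<Prod>x\<in>#B. [:- x, 1:]))"
      by (simp add: A(2))
    have "poly (pderiv P) x = 0"
      unfolding P pderiv_mult by simp
    thus False
      by (simp add: dP)
  qed
  have "set_mset A = {x. poly P x = 0}"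
    by (auto simp: A(2) poly_prod_mset prod_mset_zero_iff)
  also have "\<dots> = GF q"
    by (auto simp: GF_def P_def poly_monom)
  finally have "GF q = set_mset A" ..
  moreover have "size A = card (set_mset A)"
    unfolding size_multiset_overloaded_eq
    unfolding card_eq_sum by (rule sum.cong) (use count in \<open>auto intro!: le_antisym\<close>)
  ultimately show ?thesis
    using A(1) by simp
qed

lemma GF_prime: "GF CARD('p) = range (to_ac :: 'p :: prime_card mod_ring \<Rightarrow> _)"
proof (rule sym, rule card_subset_eq)
  have c: "card (GF CARD('p) :: 'p mod_ring alg_closure set) = CARD('p)"
    using card_GF[where 'p = 'p, of "CARD('p)" 1] by simp
  show "finite (GF CARD('p) :: 'p mod_ring alg_closure set)"
    using c card_p_gt_1[where 'p = 'p] by (metis card.infinite not_one_less_zero)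
  have "x ^ CARD('p) = x" for x :: "'p mod_ring"
    using finite_field_power_card_eq_same[of x] by simp
  thus "range to_ac \<subseteq> (GF CARD('p) :: 'p mod_ring alg_closure set)"
    unfolding GF_def by (auto simp flip: to_ac_power)
  show "card (range (to_ac :: 'p mod_ring \<Rightarrow> _)) = card (GF CARD('p) :: 'p mod_ring alg_closure set)"
    by (simp add: c card_image inj_to_ac)
qed

lemma g_poly_ex1:
  assumes q: "q = CARD('p :: prime_card) ^ k" "k > 0"
  shows "\<exists>!g :: 'p mod_ring poly.
           (\<Sum>a\<in>GF q. [:a, 1:] ^ n) = map_poly to_ac g \<circ>\<^sub>p (monom 1 q - monom 1 1)"
proof (rule ex_ex1I)
  let ?Q = "monom 1 q - monom 1 1 :: 'p mod_ring alg_closure poly"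
  have q1: "q > 1"
    unfolding q(1) by (rule one_less_power[OF card_p_gt_1 q(2)])
  have card: "card (GF q :: 'p mod_ring alg_closure set) = q"
    by (rule card_GF[OF q])
  have fin: "finite (GF q :: 'p mod_ring alg_closure set)"
    using card q1 by (metis card.infinite not_one_less_zero)
  have map_add: "map_poly to_ac (f + g) = map_poly to_ac f + map_poly to_ac g"
    and map_diff: "map_poly to_ac (f - g) = map_poly to_ac f - map_poly to_ac g"
    and map_pCons: "map_poly to_ac (pCons d f) = pCons (to_ac d) (map_poly to_ac f)"
    for f g :: "'p mod_ring poly" and d
    by (simp_all add: poly_eq_iff coeff_map_poly coeff_pCons split: nat.split)
  show "\<exists>g :: 'p mod_ring poly. (\<Sum>a\<in>GF q. [:a, 1:] ^ n) = map_poly to_ac g \<circ>\<^sub>p ?Q"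
  proof (induction n rule: less_induct)
    case (less n)
    show ?case
    proof (cases "n < q")
      case True
      define S :: "'p mod_ring alg_closure poly" where "S = (\<Sum>a\<in>GF q. [:a, 1:] ^ n)"
      define c where "c = poly S 0"
      have "poly S b = c" if b: "b \<in> GF q" for b
      proof -
        have "(\<Sum>a\<in>GF q. (a + b) ^ n) = (\<Sum>a\<in>GF q. a ^ n)"
          by (rule sum.reindex_bij_witness[of _ "\<lambda>a. a + (- b)" "\<lambda>a. a + b"])
             (use b q in \<open>simp_all add: GF_subfield del: add_uminus_conv_diff\<close>)
        thus ?thesis
          by (simp add: S_def c_def poly_sum poly_power)
      qed
      hence sub: "GF q \<subseteq> {b. poly (S - [:c:]) b = 0}"
        by auto
      have "S = [:c:]"
      proof (rule ccontr)
        assume "S \<noteq> [:c:]"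
        hence nz: "S - [:c:] \<noteq> 0"
          by simp
        have "q \<le> card {b. poly (S - [:c:]) b = 0}"
          using card_mono[OF poly_roots_finite[OF nz] sub] card by simp
        also have "\<dots> \<le> degree (S - [:c:])"
          by (rule card_poly_roots_bound[OF nz])
        also have "\<dots> \<le> n"
          unfolding S_def
          by (intro degree_diff_le degree_sum_le fin) (auto simp: degree_power_eq)
        finally show False
          using True by simp
      qed
      have "c ^ CARD('p) = c"
      proof -
        have "c ^ CARD('p) = (\<Sum>a\<in>GF q. (a ^ CARD('p)) ^ n)"
          by (simp add: c_def S_def poly_sum poly_power frobenius_sum[where k = 1] mult.commute
                   flip: power_mult)
        also have "\<dots> = (\<Sum>a\<in>GF q. a ^ n)"
        proof (rule sum.reindex_bij_betw)
          have "inj_on (\<lambda>a :: 'p mod_ring alg_closure. a ^ CARD('p)) (GF q)"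
          proof (rule inj_onI)
            fix a b :: "'p mod_ring alg_closure"
            assume ab: "a \<in> GF q" "b \<in> GF q" "a ^ CARD('p) = b ^ CARD('p)"
            have "q = CARD('p) * CARD('p) ^ (k - 1)"
              using q by (simp flip: power_Suc)
            hence "a ^ q = b ^ q"
              using ab(3) by (simp add: power_mult)
            thus "a = b"
              using ab by (simp add: GF_def)
          qed
          moreover have "(\<lambda>a. a ^ CARD('p)) ` GF q \<subseteq> (GF q :: 'p mod_ring alg_closure set)"
            by (auto simp: GF_def simp flip: power_mult)
               (metis mult.commute power_mult)
          ultimately show "bij_betw (\<lambda>a :: 'p mod_ring alg_closure. a ^ CARD('p)) (GF q) (GF q)"
            using fin by (simp add: bij_betw_def endo_inj_surj)
        qed
        also have "\<dots> = c"
          by (simp add: c_def S_def poly_sum poly_power)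
        finally show ?thesis .
      qed
      hence "c \<in> GF CARD('p)"
        by (simp add: GF_def)
      then obtain d :: "'p mod_ring" where "c = to_ac d"
        unfolding GF_prime by blast
      hence "S = map_poly to_ac [:d:] \<circ>\<^sub>p ?Q"
        using \<open>S = [:c:]\<close> by (simp add: map_pCons pcompose_pCons)
      thus ?thesis
        unfolding S_def by blast
    next
      case False
      define m where "m = n - q"
      have n: "n = m + q" "m < n" "m + 1 < n"
        using False q1 by (auto simp: m_def)
      obtain g h :: "'p mod_ring poly" where
        g: "(\<Sum>a\<in>GF q. [:a, 1:] ^ m) = map_poly to_ac g \<circ>\<^sub>p ?Q" and
        h: "(\<Sum>a\<in>GF q. [:a, 1:] ^ (m + 1)) = map_poly to_ac h \<circ>\<^sub>p ?Q"
        using less.IH n by blast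
      have lin: "[:a, 1:] ^ n = ?Q * [:a, 1:] ^ m + [:a, 1:] ^ (m + 1)"
        if "a \<in> GF q" for a :: "'p mod_ring alg_closure"
      proof -
        have "[:a, 1:] ^ q = ([:a:] + monom 1 1) ^ q"
          by (simp add: monom_altdef)
        also have "\<dots> = [:a:] ^ q + monom 1 1 ^ q"
          by (rule frobenius_poly_add[OF q(1)])
        also have "\<dots> = [:a:] + monom 1 q"
          using that by (simp add: poly_const_pow monom_power GF_def)
        also have "\<dots> = ?Q + [:a, 1:]"
          by (simp add: monom_altdef)
        finally have Frob: "[:a, 1:] ^ q = ?Q + [:a, 1:]" .
        have "[:a, 1:] ^ n = [:a, 1:] ^ q * [:a, 1:] ^ m"
          by (simp only: n(1) power_add mult.commute)
        thus ?thesis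
          by (simp only: Frob distrib_right Suc_eq_plus1[symmetric] power_Suc)
      qed
      have "(\<Sum>a\<in>GF q. [:a, 1:] ^ n)
              = ?Q * (\<Sum>a\<in>GF q. [:a, 1:] ^ m) + (\<Sum>a\<in>GF q. [:a, 1:] ^ (m + 1))"
        unfolding sum_distrib_left sum.distrib[symmetric] by (rule sum.cong) (simp_all only: lin)
      also have "\<dots> = map_poly to_ac (pCons 0 g + h) \<circ>\<^sub>p ?Q"
        unfolding g h by (simp add: map_add map_pCons pcompose_pCons pcompose_add)
      finally show ?thesis
        by blast
    qed
  qed
  fix g g' :: "'p mod_ring poly"
  assume "(\<Sum>a\<in>GF q. [:a, 1:] ^ n) = map_poly to_ac g \<circ>\<^sub>p ?Q"
    "(\<Sum>a\<in>GF q. [:a, 1:] ^ n) = map_poly to_ac g' \<circ>\<^sub>p ?Q"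
  hence "map_poly to_ac (g - g') \<circ>\<^sub>p ?Q = 0"
    by (simp add: map_diff pcompose_diff)
  moreover have "degree ?Q > 0"
  proof (rule less_le_trans[of 0 q])
    show "q \<le> degree ?Q"
      by (rule le_degree) (use q1 in simp)
  qed (use q1 in simp)
  ultimately have "map_poly to_ac (g - g') = 0"
    by (rule pcompose_eq_0)
  thus "g = g'"
    by (simp add: poly_eq_iff coeff_map_poly)
qed

end

(*
  For t = x^q - x put u = x^(q^b) - x and w = x^(q^a) - x^(q^b); both are sums of consecutive
  Frobenius conjugates of t. Since c^q = c, the summand (x + c)^(q^a - q^b - 1) is
  (x^(q^a) + c) / ((x^(q^b) + c) (x + c)), and a partial fraction decomposition together with
  \<Sum> 1 / (x + c) = - 1 / (x^q - x) gives  t t^(q^b) g(t) = - t^(q^b) - w (u^(q - 1) - 1).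
  So g(t) = - 1 / t for a nonzero t if and only if w = 0 or u is a nonzero element of the field
  with q elements. If e divides a and b and t lies in the field with q^e elements, then u and w
  are nonzero multiples of the trace of t, so one of the two alternatives holds. At t = 0 the
  congruence needs \<Sum> c^(q^a - q^b - 1) = 0, which fails for q = 2; but two distinct positive
  multiples of e below p e force p > 2.
*)

theory Submission
  imports Defs
begin

section \<open>Partial sums of Frobenius conjugates\<close>

text \<open>For \<open>j = e\<close> and \<open>t\<close> in \<open>GF (q ^ e)\<close> this is the
  trace to \<open>GF q\<close>. The type stays general because the sum is also formed for the
  polynomial \<open>monom 1 1\<close>.\<close>

definition frob_sum :: "nat \<Rightarrow> nat \<Rightarrow> 'a :: comm_semiring_1 \<Rightarrow> 'a" where
  "frob_sum q j t = (\<Sum>i<j. t ^ q ^ i)"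

lemma frob_sum_add_index:
  fixes t :: "'p :: prime_card mod_ring alg_closure"
  assumes "q = CARD('p) ^ k"
  shows "frob_sum q (i + j) t = frob_sum q i t + frob_sum q j t ^ q ^ i"
proof -
  have "frob_sum q (i + j) t = frob_sum q i t + (\<Sum>l<j. t ^ q ^ (i + l))"
    unfolding frob_sum_def by (induction j) (simp_all add: add.assoc)
  moreover have "frob_sum q j t ^ q ^ i = (\<Sum>l<j. (t ^ q ^ l) ^ q ^ i)"
    unfolding frob_sum_def by (rule frobenius_sum[of _ "k * i"]) (simp add: assms power_mult)
  ultimately show ?thesis
    by (simp add: power_add mult.commute flip: power_mult)
qed

text \<open>A sum of \<open>j + 1\<close> conjugates can be split after its first term or before its
  last one; comparing the two splittings gives the formula.\<close>

lemma frob_sum_power: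
  fixes t :: "'p :: prime_card mod_ring alg_closure"
  assumes "q = CARD('p) ^ k"
  shows "frob_sum q j t ^ q = frob_sum q j t + t ^ q ^ j - t"
  using frob_sum_add_index[OF assms, of 1 j t] frob_sum_add_index[OF assms, of j 1 t]
  by (simp add: frob_sum_def algebra_simps)

lemma frob_sum_add:
  fixes x y :: "'p :: prime_card mod_ring alg_closure"
  assumes "q = CARD('p) ^ k"
  shows "frob_sum q j (x + y) = frob_sum q j x + frob_sum q j y"
proof -
  have "(x + y) ^ q ^ i = x ^ q ^ i + y ^ q ^ i" for i
    by (rule frobenius_add[of _ "k * i"]) (simp add: assms power_mult)
  thus ?thesis
    by (simp add: frob_sum_def sum.distrib)
qed

lemma frobenius_diff:
  fixes x y :: "'p :: prime_card mod_ring alg_closure"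
  assumes "q = CARD('p) ^ k"
  shows "(x - y) ^ q = x ^ q - y ^ q"
  using frobenius_add[OF assms, of "x - y" y] by (simp add: algebra_simps)

text \<open>This links the sums at \<open>t = x ^ q - x\<close> with the differences of Frobenius
  powers of \<open>x\<close> that occur in the partial fractions.\<close>

lemma frob_sum_telescope:
  fixes x :: "'p :: prime_card mod_ring alg_closure"
  assumes "q = CARD('p) ^ k"
  shows "frob_sum q j (x ^ q - x) = x ^ q ^ j - x"
proof -
  have "(x ^ q - x) ^ q ^ i = x ^ q ^ Suc i - x ^ q ^ i" for i
    by (subst frobenius_diff[of _ "k * i"]) (simp_all add: assms power_mult flip: power_mult)
  thus ?thesis
    unfolding frob_sum_def by (simp only: sum_lessThan_telescope[of "\<lambda>i. x ^ q ^ i"]) simp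
qed

lemma GF_power_mult:
  assumes "x \<in> GF (q ^ e)"
  shows "x ^ q ^ (e * c) = x"
  using assms by (induction c) (simp_all add: GF_def power_add power_mult)

text \<open>The conjugates of \<open>x\<close> repeat with period \<open>e\<close>, so each block of
  \<open>e\<close> terms contributes one copy of the trace.\<close>

lemma frob_sum_GF:
  fixes x :: "'p :: prime_card mod_ring alg_closure"
  assumes "q = CARD('p) ^ k" "x \<in> GF (q ^ e)"
  shows "frob_sum q (e * c) x = of_nat c * frob_sum q e x"
proof (induction c)
  case (Suc c)
  have "frob_sum q e x ^ q ^ (e * c) = (\<Sum>i<e. (x ^ q ^ (e * c)) ^ q ^ i)"
    unfolding frob_sum_def using assms(1)
    by (subst frobenius_sum[of _ "k * (e * c)"]) (simp_all add: power_mult mult.commute flip: power_mult)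
  hence "frob_sum q e x ^ q ^ (e * c) = frob_sum q e x"
    by (simp add: GF_power_mult[OF assms(2)] frob_sum_def)
  moreover have "frob_sum q (e * Suc c) x = frob_sum q (e * c) x + frob_sum q e x ^ q ^ (e * c)"
    using frob_sum_add_index[OF assms(1), of "e * c" e x] by (simp add: add.commute)
  ultimately show ?case
    by (simp add: Suc.IH distrib_right)
qed (simp add: frob_sum_def)

section \<open>Polynomials and their values on finite fields\<close>

lemma finite_GF:
  assumes "q = CARD('p :: prime_card) ^ k" "k > 0"
  shows "finite (GF q :: 'p mod_ring alg_closure set)"
  using card_GF[OF assms] assms(1) card_p_gt_1[where 'p = 'p] by (intro card_ge_0_finite) simp

lemma poly_vanishing_on_GF:
  fixes f :: "'p :: prime_card mod_ring alg_closure poly"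
  assumes "q = CARD('p) ^ k" "k > 0" "degree f < q" "\<And>x. x \<in> GF q \<Longrightarrow> poly f x = 0"
  shows "f = 0"
proof (rule ccontr)
  assume "f \<noteq> 0"
  hence "card (GF q :: 'p mod_ring alg_closure set) \<le> degree f"
    using card_mono[OF poly_roots_finite, of f "GF q"] card_poly_roots_bound[of f] assms(4)
    by fastforce
  thus False
    using card_GF[OF assms(1,2)] assms(3) by simp
qed

text \<open>Some finite subfield of the closure has more elements than the degree of
  \<open>f\<close>.\<close>

lemma poly_vanishing_everywhere:
  fixes f :: "'p :: prime_card mod_ring alg_closure poly"
  assumes "\<And>x. poly f x = 0"
  shows "f = 0"
proof (rule poly_vanishing_on_GF[OF refl])
  show "degree f < CARD('p) ^ Suc (degree f)"
    using power_gt_expt[of "CARD('p)" "Suc (degree f)"] card_p_gt_1[where 'p = 'p] by linarith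
qed (simp_all add: assms)

lemma degree_monom_diff:
  assumes "q > 1"
  shows "degree (monom 1 q - monom 1 1 :: 'a :: comm_ring_1 poly) = q"
  unfolding diff_conv_add_uminus
  by (subst degree_add_eq_left) (use assms in \<open>simp_all add: degree_monom_eq\<close>)

text \<open>The modulus vanishes on \<open>GF q\<close>, so \<open>f - g\<close> and its remainder
  agree there; the remainder has degree below \<open>q\<close> and is zero as soon as it has
  \<open>q\<close> roots.\<close>

lemma cong_iff_eq_on_GF:
  fixes f g :: "'p :: prime_card mod_ring poly"
  assumes "q = CARD('p) ^ k" "k > 0"
  shows "[f = g] (mod (monom 1 q - monom 1 1)) \<longleftrightarrow>
           (\<forall>x\<in>GF q. poly (map_poly to_ac f) x = poly (map_poly to_ac g) x)"
proof -
  interpret field_hom "to_ac :: 'p mod_ring \<Rightarrow> _"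
    by unfold_locales simp_all
  interpret map_poly_inj_idom_hom "to_ac :: 'p mod_ring \<Rightarrow> _" ..
  let ?M = "monom 1 q - monom 1 1 :: 'p mod_ring poly"
  define r where "r = (f - g) mod ?M"
  have q1: "q > 1"
    unfolding assms(1) by (rule one_less_power[OF card_p_gt_1 assms(2)])
  have M0: "?M \<noteq> 0"
    using degree_monom_diff[OF q1, where 'a = "'p mod_ring"] q1 by auto
  have deg: "degree (map_poly to_ac r) < q"
    using degree_mod_less[OF M0, of "f - g"] q1
    unfolding r_def[symmetric] degree_monom_diff[OF q1] by auto
  have M: "poly (map_poly to_ac ?M) x = 0" if "x \<in> GF q" for x
    using that by (simp add: hom_distribs poly_monom GF_def)
  have "f - g = ?M * ((f - g) div ?M) + r"
    by (simp add: r_def)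
  hence "map_poly to_ac f - map_poly to_ac g =
      map_poly to_ac ?M * map_poly to_ac ((f - g) div ?M) + map_poly to_ac r"
    by (metis hom_add hom_minus hom_mult)
  hence r: "poly (map_poly to_ac f) x - poly (map_poly to_ac g) x = poly (map_poly to_ac r) x"
    if "x \<in> GF q" for x
    using M[OF that] by (metis (no_types, lifting) add_0 mult_zero_left poly_add poly_diff poly_mult)
  have "[f = g] (mod ?M) \<longleftrightarrow> r = 0"
    by (simp add: cong_iff_dvd_diff r_def dvd_eq_mod_eq_0)
  also have "\<dots> \<longleftrightarrow> map_poly to_ac r = 0"
    by simp
  also have "\<dots> \<longleftrightarrow> (\<forall>x\<in>GF q. poly (map_poly to_ac r) x = 0)"
    using poly_vanishing_on_GF[OF assms deg] by auto
  also have "\<dots> \<longleftrightarrow> (\<forall>x\<in>GF q. poly (map_poly to_ac f) x = poly (map_poly to_ac g) x)"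
    using r by (metis eq_iff_diff_eq_0)
  finally show ?thesis .
qed

section \<open>The factorisation of \<open>X ^ q - X\<close> and sums of inverses\<close>

lemma prod_linear_GF:
  assumes "q = CARD('p :: prime_card) ^ k" "k > 0"
  shows "(\<Prod>c\<in>GF q. [:c, 1:]) = (monom 1 q - monom 1 1 :: 'p mod_ring alg_closure poly)"
proof -
  let ?P = "\<Prod>c\<in>GF q. [:c, 1:] :: 'p mod_ring alg_closure poly"
  let ?R = "monom 1 q - monom 1 1 :: 'p mod_ring alg_closure poly"
  have q1: "q > 1"
    unfolding assms(1) by (rule one_less_power[OF card_p_gt_1 assms(2)])
  have degP: "degree ?P = q"
    by (subst degree_prod_sum_eq) (simp_all add: card_GF[OF assms])
  \<comment> \<open>Both polynomials are monic of degree \<open>q\<close>, so the difference has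
    smaller degree and its \<open>q\<close> roots force it to vanish.\<close>
  have "lead_coeff ?P = 1"
    by (simp add: lead_coeff_prod)
  hence "coeff (?P - ?R) q = 0"
    using q1 by (simp add: degP)
  moreover have "degree (?P - ?R) \<le> q"
    using degP degree_monom_diff[OF q1, where 'a = "'p mod_ring alg_closure"]
    by (intro degree_diff_le_max[THEN order_trans]) simp
  ultimately have "?P - ?R = 0 \<or> degree (?P - ?R) < q"
    by (intro eq_zero_or_degree_less)
  moreover have "poly (?P - ?R) x = 0" if "x \<in> GF q" for x
  proof -
    have "- x \<in> GF q"
      using GF_subfield(4)[OF assms(1) that that] .
    hence "(\<Prod>c\<in>GF q. x + c) = 0"
      using finite_GF[OF assms] by (intro prod_zero) (auto intro!: bexI[of _ "- x"])
    thus ?thesis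
      using that by (simp add: poly_prod poly_monom GF_def add.commute)
  qed
  ultimately show ?thesis
    using poly_vanishing_on_GF[OF assms, of "?P - ?R"] by auto
qed

text \<open>This is the logarithmic derivative of \<open>X ^ q - X = (\<Prod>c\<in>GF q. X + c)\<close>.\<close>

lemma sum_inverse_GF:
  fixes x :: "'p :: prime_card mod_ring alg_closure"
  assumes "q = CARD('p) ^ k" "k > 0" "x \<notin> GF q"
  shows "(\<Sum>c\<in>GF q. inverse (x + c)) = - inverse (x ^ q - x)"
proof -
  note fin = finite_GF[OF assms(1,2)]
  have nz: "x + c \<noteq> 0" if "c \<in> GF q" for c
    using GF_subfield(4)[OF assms(1) that that] assms(3) by (auto simp: add_eq_0_iff2)
  have "of_nat q = (0 :: 'p mod_ring alg_closure)"
    unfolding of_nat_eq_0_iff_char_dvd using assms by simp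
  hence "pderiv (\<Prod>c\<in>GF q. [:c, 1:]) = (- 1 :: 'p mod_ring alg_closure poly)"
    by (simp add: prod_linear_GF[OF assms(1,2)] pderiv_diff pderiv_monom)
  hence "poly (\<Sum>c\<in>GF q. \<Prod>d\<in>GF q - {c}. [:d, 1:]) x = - 1"
    by (simp add: pderiv_prod pderiv_pCons)
  hence "- 1 = (\<Sum>c\<in>GF q. \<Prod>d\<in>GF q - {c}. x + d)"
    by (simp add: poly_sum poly_prod add.commute)
  also have "\<dots> = (\<Sum>c\<in>GF q. (\<Prod>d\<in>GF q. x + d) * inverse (x + c))"
  proof (rule sum.cong[OF refl])
    fix c :: "'p mod_ring alg_closure" assume c: "c \<in> GF q"
    show "(\<Prod>d\<in>GF q - {c}. x + d) = (\<Prod>d\<in>GF q. x + d) * inverse (x + c)"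
      using nz[OF c] by (simp add: prod.remove[OF fin c])
  qed
  also have "(\<Prod>d\<in>GF q. x + d) = x ^ q - x"
    using arg_cong[OF prod_linear_GF[OF assms(1,2)], of "\<lambda>f. poly f x"]
    by (simp add: poly_prod poly_monom add.commute)
  finally have "(x ^ q - x) * (\<Sum>c\<in>GF q. inverse (x + c)) = - 1"
    by (simp add: sum_distrib_left)
  moreover have "x ^ q - x \<noteq> 0"
    using assms(3) by (simp add: GF_def)
  ultimately show ?thesis
    by (simp add: field_simps)
qed

section \<open>The identity for the values of \<open>g\<close>\<close>

lemma g_poly_eval:
  fixes x :: "'p :: prime_card mod_ring alg_closure"
  assumes "q = CARD('p) ^ k" "k > 0"
  shows "poly (map_poly to_ac (g_poly n q)) (x ^ q - x) = (\<Sum>c\<in>GF q. (x + c) ^ n)"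
  using arg_cong[OF theI'[OF g_poly_ex1[OF assms, of n], folded g_poly_def], of "\<lambda>f. poly f x"]
  by (simp add: poly_sum poly_pcompose poly_monom poly_power add.commute)

text \<open>The nonvanishing assumptions serve the partial fractions: \<open>t\<close> nonzero keeps
  all denominators nonzero, and \<open>frob_sum q b t\<close> nonzero keeps the two poles
  apart.\<close>

lemma g_poly_identity_generic:
  fixes t :: "'p :: prime_card mod_ring alg_closure"
  assumes q: "q = CARD('p) ^ k" "k > 0" and ab: "b < a"
    and t: "t \<noteq> 0" "frob_sum q b t \<noteq> 0"
  shows "t * t ^ q ^ b * poly (map_poly to_ac (g_poly (q ^ a - q ^ b - 1) q)) t
           = - (t ^ q ^ b) - frob_sum q (a - b) t ^ q ^ b * (frob_sum q b t ^ (q - 1) - 1)"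
proof -
  have q1: "q > 1"
    unfolding q(1) by (rule one_less_power[OF card_p_gt_1 q(2)])
  have frob: "q ^ j = CARD('p) ^ (k * j)" for j
    by (simp add: q power_mult)
  \<comment> \<open>A root of \<open>X ^ q - X - t\<close> in the closure writes \<open>t\<close> as
    \<open>x ^ q - x\<close>, the form in which \<open>g\<close> can be evaluated.\<close>
  define P where "P = monom 1 q - [:t, 1:]"
  have "degree P = q"
    unfolding P_def diff_conv_add_uminus
    by (subst degree_add_eq_left) (use q1 in \<open>simp_all add: degree_monom_eq\<close>)
  then obtain x where "poly P x = 0"
    using alg_closed_imp_poly_has_root[of P] q1 by auto
  hence x: "t = x ^ q - x"
    by (simp add: P_def poly_monom algebra_simps)
  define Y where "Y = x ^ q ^ b"
  define u where "u = frob_sum q b t"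
  define w where "w = frob_sum q (a - b) t ^ q ^ b"
  have Y: "Y = x + u"
    by (simp add: u_def Y_def x frob_sum_telescope[OF q(1)])
  have "frob_sum q b t + w = x ^ q ^ a - x"
    using frob_sum_add_index[OF q(1), of b "a - b" t] ab
    by (simp add: w_def x frob_sum_telescope[OF q(1)])
  hence Z: "x ^ q ^ a = x + u + w"
    by (simp add: u_def algebra_simps)
  \<comment> \<open>Thus \<open>Y\<close> plays for \<open>t ^ q ^ b\<close> the role that
    \<open>x\<close> plays for \<open>t\<close>, and the sum of inverses is known at both
    points.\<close>
  have t': "t ^ q ^ b = Y ^ q - Y"
    unfolding x frobenius_diff[OF frob] by (simp add: Y_def mult.commute flip: power_mult)
  have xG: "x \<notin> GF q" and YG: "Y \<notin> GF q"
    using t t' by (auto simp: GF_def x)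
  have "(x + c) ^ (q ^ a - q ^ b - 1)
          = inverse u * ((u + w) * inverse (x + c) - w * inverse (Y + c))" if c: "c \<in> GF q" for c
  proof -
    have "- c \<in> GF q"
      using GF_subfield(4)[OF q(1) c c] .
    hence nz: "x + c \<noteq> 0" "Y + c \<noteq> 0"
      using xG YG by (auto simp: add_eq_0_iff2)
    have cj: "c ^ q ^ j = c" for j
      using c GF_power_mult[of c q 1 j] by simp
    have "q ^ b < q ^ a"
      using ab q1 by simp
    \<comment> \<open>The truncated subtractions are exact.\<close>
    hence "q ^ a = (q ^ a - q ^ b - 1) + q ^ b + 1"
      by simp
    hence "(x + c) ^ q ^ a = (x + c) ^ (q ^ a - q ^ b - 1) * (x + c) ^ q ^ b * (x + c)"
      by (metis power_add power_one_right)
    hence "(x + c) ^ (q ^ a - q ^ b - 1) * (Y + c) * (x + c) = x + u + w + c"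
      by (simp add: frobenius_add[OF frob] cj Y_def Z)
    hence "(x + c) ^ (q ^ a - q ^ b - 1) = (x + u + w + c) / ((Y + c) * (x + c))"
      using nz by (subst eq_divide_eq) (simp add: mult.assoc)
    \<comment> \<open>Partial fractions in \<open>c\<close>, with \<open>Y - x = u\<close> as the
      distance of the poles.\<close>
    also have "\<dots> = inverse u * ((u + w) * inverse (x + c) - w * inverse (Y + c))"
      using nz t(2) unfolding u_def[symmetric] by (simp add: field_simps Y)
    finally show ?thesis .
  qed
  hence "(\<Sum>c\<in>GF q. (x + c) ^ (q ^ a - q ^ b - 1))
      = inverse u * ((u + w) * (\<Sum>c\<in>GF q. inverse (x + c)) - w * (\<Sum>c\<in>GF q. inverse (Y + c)))"
    by (simp add: sum_distrib_left sum_subtractf right_diff_distrib)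
  also have "\<dots> = inverse u * (w * inverse (t ^ q ^ b) - (u + w) * inverse t)"
    by (simp add: sum_inverse_GF[OF q xG] sum_inverse_GF[OF q YG] flip: x t')
  finally have "t * t ^ q ^ b * u * poly (map_poly to_ac (g_poly (q ^ a - q ^ b - 1) q)) t
      = w * t - (u + w) * t ^ q ^ b"
    using g_poly_eval[OF q, of "q ^ a - q ^ b - 1" x] t by (simp add: u_def flip: x) (simp add: field_simps)
  also have "\<dots> = - u * t ^ q ^ b - w * (t ^ q ^ b - t)"
    by (simp add: algebra_simps)
  \<comment> \<open>This exhibits a factor \<open>u\<close> on the right as well, so that
    \<open>u\<close> can be cancelled.\<close>
  also have "t ^ q ^ b - t = u * (u ^ (q - 1) - 1)"
    using frob_sum_power[OF q(1), of b t] q1 by (simp add: u_def algebra_simps power_eq_if)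
  finally have "u * (t * t ^ q ^ b * poly (map_poly to_ac (g_poly (q ^ a - q ^ b - 1) q)) t)
      = u * (- (t ^ q ^ b) - w * (u ^ (q - 1) - 1))"
    by (simp add: algebra_simps)
  thus ?thesis
    using t(2) by (simp add: u_def w_def)
qed

text \<open>Only the term \<open>i = 0\<close> contributes to the coefficient of \<open>X\<close>,
  since \<open>q ^ i > 1\<close> for positive \<open>i\<close>.\<close>

lemma frob_sum_monom_nonzero:
  assumes "q = CARD('p :: prime_card) ^ k" "k > 0" "j > 0"
  shows "frob_sum q j (monom 1 1 :: 'p mod_ring alg_closure poly) \<noteq> 0"
proof
  have q1: "q > 1"
    unfolding assms(1) by (rule one_less_power[OF card_p_gt_1 assms(2)])
  assume "frob_sum q j (monom 1 1 :: 'p mod_ring alg_closure poly) = 0"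
  moreover have "coeff (frob_sum q j (monom 1 1 :: 'p mod_ring alg_closure poly)) 1
      = (\<Sum>i<j. if i = 0 then 1 else 0)"
    unfolding frob_sum_def coeff_sum
    by (rule sum.cong) (use q1 in \<open>auto simp: monom_power\<close>)
  ultimately show False
    using assms(3) by simp
qed

text \<open>Both sides are polynomials in \<open>t\<close>, so the exceptional points of the generic
  case can be removed; they include the points where a trace vanishes.\<close>

lemma g_poly_identity:
  fixes t :: "'p :: prime_card mod_ring alg_closure"
  assumes q: "q = CARD('p) ^ k" "k > 0" and b: "0 < b" and ab: "b < a"
  shows "t * t ^ q ^ b * poly (map_poly to_ac (g_poly (q ^ a - q ^ b - 1) q)) t
           = - (t ^ q ^ b) - frob_sum q (a - b) t ^ q ^ b * (frob_sum q b t ^ (q - 1) - 1)"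
proof -
  define v :: "'p mod_ring alg_closure poly" where "v = monom 1 1"
  define D where "D = v * v ^ q ^ b * map_poly to_ac (g_poly (q ^ a - q ^ b - 1) q)
    + v ^ q ^ b + frob_sum q (a - b) v ^ q ^ b * (frob_sum q b v ^ (q - 1) - 1)"
  have poly_v: "poly v s = s" "poly (frob_sum q j v) s = frob_sum q j s" for j s
    by (simp_all add: v_def frob_sum_def poly_sum poly_power poly_monom)
  have D: "poly D s = s * s ^ q ^ b * poly (map_poly to_ac (g_poly (q ^ a - q ^ b - 1) q)) s
    + s ^ q ^ b + frob_sum q (a - b) s ^ q ^ b * (frob_sum q b s ^ (q - 1) - 1)" for s
    by (simp add: D_def poly_v poly_power)
  \<comment> \<open>The extra factor vanishes exactly at the exceptional points and is a nonzero
    polynomial, so it can be cancelled afterwards.\<close>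
  have "poly (D * (v * frob_sum q b v)) s = 0" for s
  proof (cases "s = 0 \<or> frob_sum q b s = 0")
    case False
    hence "poly D s = 0"
      unfolding D by (subst g_poly_identity_generic[OF q ab]) auto
    thus ?thesis
      by simp
  qed (auto simp: poly_v)
  hence "D * (v * frob_sum q b v) = 0"
    by (rule poly_vanishing_everywhere)
  moreover have "v \<noteq> 0"
    by (simp add: v_def)
  moreover have "frob_sum q b v \<noteq> 0"
    unfolding v_def by (rule frob_sum_monom_nonzero[OF q b])
  ultimately have "D = 0"
    by simp
  hence "poly D t = 0"
    by simp
  thus ?thesis
    unfolding D eq_diff_eq eq_neg_iff_add_eq_0 by (simp only: add_ac)
qed

section \<open>The pointwise criterion\<close>

lemma GF_power_minus_two:
  assumes "x \<in> GF Q" "Q \<ge> 3"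
  shows "x ^ (Q - 2) = inverse x"
proof (cases "x = 0")
  case False
  have "x * (x * x ^ (Q - 2)) = x ^ (Suc (Suc (Q - 2)))"
    by simp
  also have "\<dots> = x"
    using assms by (simp add: GF_def numeral_2_eq_2 Suc_diff_Suc)
  finally show ?thesis
    using False by (simp add: field_simps)
\<comment> \<open>At zero both sides are zero: the exponent is positive and
  \<open>inverse 0 = 0\<close>.\<close>
qed (use assms in simp)

text \<open>After multiplication by \<open>x * x ^ q ^ b\<close> the identity leaves a product that
  must vanish, and its power \<open>q ^ b\<close> does not affect vanishing.\<close>

lemma g_poly_eval_iff:
  fixes x :: "'p :: prime_card mod_ring alg_closure"
  assumes q: "q = CARD('p) ^ k" "k > 0" and b: "0 < b" and ab: "b < a" and x: "x \<noteq> 0"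
  shows "poly (map_poly to_ac (g_poly (q ^ a - q ^ b - 1) q)) x = - inverse x
           \<longleftrightarrow> frob_sum q (a - b) x = 0 \<or> frob_sum q b x ^ (q - 1) = 1"
proof -
  let ?G = "poly (map_poly to_ac (g_poly (q ^ a - q ^ b - 1) q)) x"
  have "?G = - inverse x \<longleftrightarrow> x * x ^ q ^ b * ?G = x * x ^ q ^ b * - inverse x"
    using x by (subst mult_cancel_left) simp
  also have "x * x ^ q ^ b * - inverse x = - (x ^ q ^ b)"
    using x by simp
  also have "x * x ^ q ^ b * ?G = - (x ^ q ^ b) \<longleftrightarrow>
      frob_sum q (a - b) x ^ q ^ b * (frob_sum q b x ^ (q - 1) - 1) = 0"
    unfolding g_poly_identity[OF q b ab] by simp
  finally show ?thesis
    using q by simp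
qed

section \<open>The criterion on the whole field and divisibility by \<open>e\<close>\<close>

lemma dvd_of_power_eq_on_GF:
  assumes q: "q = CARD('p :: prime_card) ^ k" "k > 0" and e: "e > 0"
    and fixed: "\<And>x :: 'p mod_ring alg_closure. x \<in> GF (q ^ e) \<Longrightarrow> x ^ q ^ m = x"
  shows "e dvd m"
proof (rule ccontr)
  define r where "r = m mod e"
  assume "\<not> e dvd m"
  hence r: "r > 0" "r < e"
    using e by (simp_all add: r_def dvd_eq_mod_eq_0)
  have q1: "q > 1"
    unfolding q(1) by (rule one_less_power[OF card_p_gt_1 q(2)])
  have qj: "q ^ j = CARD('p) ^ (k * j)" for j
    by (simp add: q power_mult)
  \<comment> \<open>Reducing the exponent modulo \<open>e\<close> would put a field of
    \<open>q ^ e\<close> elements inside one of \<open>q ^ r\<close> elements with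
    \<open>r < e\<close>.\<close>
  have "(GF (q ^ e) :: 'p mod_ring alg_closure set) \<subseteq> GF (q ^ r)"
  proof
    fix x :: "'p mod_ring alg_closure" assume x: "x \<in> GF (q ^ e)"
    have "x = x ^ q ^ (e * (m div e) + r)"
      using fixed[OF x] by (simp add: r_def)
    also have "\<dots> = (x ^ q ^ (e * (m div e))) ^ q ^ r"
      by (simp add: power_add power_mult)
    finally show "x \<in> GF (q ^ r)"
      by (simp add: GF_power_mult[OF x] GF_def)
  qed
  moreover have "k * r > 0" "k * e > 0"
    using q(2) e r by simp_all
  ultimately have "q ^ e \<le> q ^ r"
    using card_mono[OF finite_GF[OF qj]] card_GF[OF qj] by metis
  thus False
    using r q1 by simp
qed

text \<open>As a polynomial the trace is nonzero of degree below \<open>q ^ e\<close>, too small to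
  vanish on the whole field.\<close>

lemma frob_sum_nonzero_on_GF:
  assumes q: "q = CARD('p :: prime_card) ^ k" "k > 0" and e: "e > 0"
  shows "\<exists>x \<in> GF (q ^ e). frob_sum q e (x :: 'p mod_ring alg_closure) \<noteq> 0"
proof (rule ccontr)
  assume "\<not> ?thesis"
  hence *: "frob_sum q e x = 0" if "x \<in> GF (q ^ e)" for x :: "'p mod_ring alg_closure"
    using that by blast
  let ?T = "frob_sum q e (monom 1 1) :: 'p mod_ring alg_closure poly"
  have q1: "q > 1"
    unfolding q(1) by (rule one_less_power[OF card_p_gt_1 q(2)])
  have "?T = 0"
  proof (rule poly_vanishing_on_GF)
    show "q ^ e = CARD('p) ^ (k * e)" "k * e > 0"
      using q e by (simp_all add: power_mult)
    show "degree ?T < q ^ e"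
      unfolding frob_sum_def
      by (rule degree_sum_less) (use q1 in \<open>simp_all add: monom_power degree_monom_eq\<close>)
    show "poly ?T x = 0" if "x \<in> GF (q ^ e)" for x
      using *[OF that] by (simp add: frob_sum_def poly_sum poly_monom poly_power)
  qed
  thus False
    using frob_sum_monom_nonzero[OF q e] by simp
qed

text \<open>
  \<open>K\<close> is the kernel of \<open>frob_sum q (a - b)\<close> on \<open>F\<close>. It is proper, so translating by a point outside
  it shows that \<open>frob_sum q b\<close> maps \<open>K\<close>, and hence all of \<open>F\<close>, into the field with \<open>q\<close> elements.
  Then \<open>frob_sum q b\<close> is a nonzero multiple of the trace, and \<open>K\<close> contains all \<open>x ^ q - x\<close>.
\<close>

lemma dvd_of_frob_sum_condition:
  assumes q: "q = CARD('p :: prime_card) ^ k" "k > 0" and e: "e > 0"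
    and ab: "0 < b" "b < a" "a < CARD('p) * e"
    and cond: "\<And>x :: 'p mod_ring alg_closure. x \<in> GF (q ^ e) \<Longrightarrow> x \<noteq> 0 \<Longrightarrow>
                 frob_sum q (a - b) x = 0 \<or> frob_sum q b x ^ (q - 1) = 1"
  shows "e dvd b" "e dvd a - b"
proof -
  define F :: "'p mod_ring alg_closure set" where "F = GF (q ^ e)"
  define K where "K = {x \<in> F. frob_sum q (a - b) x = 0}"
  have q1: "q > 1"
    unfolding q(1) by (rule one_less_power[OF card_p_gt_1 q(2)])
  have qe: "q ^ e = CARD('p) ^ (k * e)"
    by (simp add: q power_mult)
  note F = GF_subfield[OF qe, folded F_def]
  note S_add = frob_sum_add[OF q(1)]
  have F_diff: "x ^ q - x \<in> F" if "x \<in> F" for x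
  proof -
    have "x ^ q \<in> F"
      using that by (simp add: F_def GF_def power_mult[symmetric] mult.commute[of q]) (simp add: power_mult)
    thus ?thesis
      using F(3)[of "x ^ q" "- x"] F(4)[OF that that] by simp
  qed
  \<comment> \<open>This is where the bound \<open>a < CARD('p) * e\<close> enters: multipliers
    strictly between 0 and the characteristic are invertible.\<close>
  have of_nat: "of_nat c \<noteq> (0 :: 'p mod_ring alg_closure)" if "0 < e * c" "e * c < CARD('p) * e" for c
  proof -
    have "\<not> CARD('p) dvd c"
      using that by (auto simp: mult.commute dest: dvd_imp_le)
    thus ?thesis
      unfolding of_nat_eq_0_iff_char_dvd by simp
  qed
  have S_fixed: "frob_sum q b x \<in> GF q" if "x \<in> F - K" for x
  proof -
    have "x \<noteq> 0"
      using that q1 by (auto simp: K_def frob_sum_def power_0_left)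
    hence "frob_sum q b x ^ (q - 1) = 1"
      using cond[of x] that by (auto simp: K_def F_def)
    thus ?thesis
      using q1 by (simp add: GF_def power_eq_if)
  qed
  \<comment> \<open>If \<open>K\<close> were all of \<open>F\<close>, then \<open>e\<close> would
    divide \<open>a - b\<close>, and the sum of length \<open>a - b\<close> would be an invertible
    multiple of the trace, which is not identically zero.\<close>
  have "\<exists>y. y \<in> F - K"
  proof (rule ccontr)
    assume "\<not> ?thesis"
    hence S0: "frob_sum q (a - b) x = 0" if "x \<in> F" for x
      using that by (auto simp: K_def)
    have "x ^ q ^ (a - b) = x" if "x \<in> F" for x
      using S0[OF F_diff[OF that]] by (simp add: frob_sum_telescope[OF q(1)])
    hence "e dvd a - b"
      using dvd_of_power_eq_on_GF[OF q e] by (simp add: F_def)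
    then obtain c where c: "a - b = e * c" ..
    obtain x :: "'p mod_ring alg_closure" where "x \<in> F" "frob_sum q e x \<noteq> 0"
      using frob_sum_nonzero_on_GF[OF q e] unfolding F_def by blast
    moreover have "of_nat c \<noteq> (0 :: 'p mod_ring alg_closure)"
      by (rule of_nat) (use ab c in linarith)+
    ultimately show False
      using S0[of x] by (simp add: c frob_sum_GF[OF q(1)] F_def)
  qed
  then obtain y where y: "y \<in> F - K" ..
  have "x ^ q ^ b = x" if x: "x \<in> F" for x
  proof -
    have "frob_sum q b x \<in> GF q"
    proof (cases "x \<in> K")
      case True
      hence "x + y \<in> F - K"
        using x y F(3) by (auto simp: K_def S_add)
      hence "frob_sum q b x + frob_sum q b y \<in> GF q"
        using S_fixed[of "x + y"] by (simp add: S_add)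
      thus ?thesis
        using GF_subfield(3)[OF q(1), of "frob_sum q b x + frob_sum q b y" "- frob_sum q b y"]
          GF_subfield(4)[OF q(1) S_fixed[OF y] S_fixed[OF y]] by simp
    qed (use x S_fixed in blast)
    \<comment> \<open>By \<open>frob_sum_power\<close>, the sum lies in \<open>GF q\<close> exactly
      when \<open>x ^ q ^ b = x\<close>.\<close>
    thus ?thesis
      using frob_sum_power[OF q(1), of b x] by (simp add: GF_def)
  qed
  thus "e dvd b"
    using dvd_of_power_eq_on_GF[OF q e] by (simp add: F_def)
  then obtain c where c: "b = e * c" ..
  have "x ^ q ^ (a - b) = x" if x: "x \<in> F" for x
  proof -
    have "frob_sum q e (x ^ q - x) = 0"
      using GF_power_mult[of x q e 1] x by (simp add: frob_sum_telescope[OF q(1)] F_def)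
    hence "frob_sum q b (x ^ q - x) = 0"
      using F_diff[OF x] by (simp add: c frob_sum_GF[OF q(1)] F_def)
    \<comment> \<open>The second alternative is excluded because a power of zero with positive
      exponent is not 1.\<close>
    hence "frob_sum q (a - b) (x ^ q - x) = 0"
      using cond[of "x ^ q - x"] F_diff[OF x] q1
      by (cases "x ^ q - x = 0") (auto simp: F_def frob_sum_def power_0_left)
    thus ?thesis
      by (simp add: frob_sum_telescope[OF q(1)])
  qed
  thus "e dvd a - b"
    using dvd_of_power_eq_on_GF[OF q e] by (simp add: F_def)
qed

text \<open>Either the trace of \<open>x\<close> vanishes and takes the first sum with it, or the
  second sum is a nonzero element of \<open>GF q\<close>; the bound on \<open>b\<close> keeps the
  multiplier \<open>b / e\<close> prime to the characteristic.\<close>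

lemma frob_sum_condition_of_dvd:
  fixes x :: "'p :: prime_card mod_ring alg_closure"
  assumes q: "q = CARD('p) ^ k" "k > 0"
    and ab: "0 < b" "b < CARD('p) * e" and dvd: "e dvd b" "e dvd m" and x: "x \<in> GF (q ^ e)"
  shows "frob_sum q m x = 0 \<or> frob_sum q b x ^ (q - 1) = 1"
proof (cases "frob_sum q e x = 0")
  case True
  thus ?thesis
    using dvd(2) frob_sum_GF[OF q(1) x] by auto
next
  case False
  have q1: "q > 1"
    unfolding q(1) by (rule one_less_power[OF card_p_gt_1 q(2)])
  obtain c where c: "b = e * c"
    using dvd(1) ..
  have "\<not> CARD('p) dvd c"
    using ab by (auto simp: c mult.commute dest: dvd_imp_le)
  hence "of_nat c \<noteq> (0 :: 'p mod_ring alg_closure)"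
    unfolding of_nat_eq_0_iff_char_dvd by simp
  hence nz: "frob_sum q b x \<noteq> 0"
    using False by (simp add: c frob_sum_GF[OF q(1) x])
  have "frob_sum q b x * frob_sum q b x ^ (q - 1) = frob_sum q b x ^ q"
    using q1 by (simp add: power_eq_if)
  also have "\<dots> = frob_sum q b x"
    using GF_power_mult[OF x, of c] by (simp add: frob_sum_power[OF q(1)] c)
  finally show ?thesis
    using nz by simp
qed

section \<open>The value at zero and the final equivalence\<close>

lemma g_poly_eval_0_odd:
  assumes q: "q = CARD('p :: prime_card) ^ k" "k > 0" and p: "CARD('p) \<noteq> 2" and n: "odd n"
  shows "poly (map_poly to_ac (g_poly n q)) (0 :: 'p mod_ring alg_closure) = 0"
proof -
  let ?s = "\<Sum>c\<in>GF q. c ^ n :: 'p mod_ring alg_closure"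
  have q0: "q > 0"
    using q by simp
  \<comment> \<open>Negation permutes \<open>GF q\<close> and reverses the sign of every odd power,
    so twice the sum is zero.\<close>
  have "?s = (\<Sum>c\<in>GF q. (- c) ^ n)"
    by (rule sum.reindex_bij_witness[of _ uminus uminus]) (use GF_subfield(4)[OF q(1)] in auto)
  also have "\<dots> = - ?s"
    using n by (simp add: power_minus_odd sum_negf)
  finally have "of_nat 2 * ?s = 0"
    unfolding eq_neg_iff_add_eq_0 of_nat_numeral mult_2 .
  moreover have "\<not> CARD('p) dvd 2"
    using p card_p_gt_1[where 'p = 'p] dvd_imp_le[of "CARD('p)" 2] by auto
  hence "of_nat 2 \<noteq> (0 :: 'p mod_ring alg_closure)"
    unfolding of_nat_eq_0_iff_char_dvd by simp
  ultimately have "?s = 0"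
    by simp
  thus ?thesis
    using g_poly_eval[OF q, of n 0] q0 by (simp add: power_0_left)
qed

theorem theorem5p3:
  fixes p q e k a b :: nat
  assumes "p = CARD('p :: prime_card)"
    and "k \<ge> 1" and "q = p ^ k"
    and "e \<ge> 2"
    and "0 < b" and "b < a" and "a < p * e"
  shows "([g_poly (q ^ a - q ^ b - 1) q = - monom (1 :: 'p mod_ring) (q ^ e - 2)]
            (mod (monom 1 (q ^ e) - monom 1 1))
          \<longleftrightarrow> [a = b] (mod e) \<and> [b = 0] (mod e))
       \<and> ([a = b] (mod e) \<and> [b = 0] (mod e)
          \<longrightarrow> permutation_poly_on (GF (q ^ e))
                (g_poly (q ^ a - q ^ b - 1) q :: 'p mod_ring poly))"
proof -
  have map_poly_minus_monom: "map_poly to_ac (- monom (1 :: 'p mod_ring) m) = - monom 1 m" for m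
    by (simp add: poly_eq_iff coeff_map_poly)
  define n where "n = q ^ a - q ^ b - 1"
  define G where "G = poly (map_poly to_ac (g_poly n q :: 'p mod_ring poly))"
  have q: "q = CARD('p) ^ k" "k > 0" and e: "e > 0"
    using assms by auto
  have q1: "q > 1"
    unfolding q(1) by (rule one_less_power[OF card_p_gt_1 q(2)])
  have qe: "q ^ e = CARD('p) ^ (k * e)" "k * e > 0"
    using q e by (simp_all add: power_mult)
  \<comment> \<open>The bound \<open>e \<ge> 2\<close> ensures that \<open>x ^ (q ^ e - 2)\<close>
    is \<open>inverse x\<close> even at zero.\<close>
  have "2 ^ 2 \<le> q ^ 2" "q ^ 2 \<le> q ^ e"
    using q1 assms(4) by (intro power_mono power_increasing; simp)+
  hence qe3: "q ^ e \<ge> 3"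
    by simp
  have cong: "[a = b] (mod e) \<and> [b = 0] (mod e) \<longleftrightarrow> e dvd b \<and> e dvd a - b"
    using assms(6) by (auto simp: cong_0_iff cong_altdef_nat)
  have "poly (map_poly to_ac (- monom (1 :: 'p mod_ring) (q ^ e - 2))) x = - inverse x"
    if "x \<in> GF (q ^ e)" for x
    using GF_power_minus_two[OF that qe3] by (simp add: map_poly_minus_monom poly_monom)
  hence G: "[g_poly n q = - monom (1 :: 'p mod_ring) (q ^ e - 2)] (mod (monom 1 (q ^ e) - monom 1 1))
      \<longleftrightarrow> (\<forall>x\<in>GF (q ^ e). G x = - inverse x)"
    unfolding cong_iff_eq_on_GF[OF qe] G_def by simp
  have forward: "e dvd b \<and> e dvd a - b" if "\<forall>x\<in>GF (q ^ e). G x = - inverse x"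
    using that dvd_of_frob_sum_condition[OF q e assms(5,6)] assms(1,7)
      g_poly_eval_iff[OF q assms(5,6)] unfolding G_def n_def by blast
  have backward: "\<forall>x\<in>GF (q ^ e). G x = - inverse x" if dvd: "e dvd b" "e dvd a - b"
  proof
    fix x :: "'p mod_ring alg_closure" assume x: "x \<in> GF (q ^ e)"
    show "G x = - inverse x"
    proof (cases "x = 0")
      case True
      \<comment> \<open>Two positive integers with sum below \<open>p\<close> exclude
        \<open>p = 2\<close>, so \<open>q\<close> is odd and the exponent \<open>n\<close> is an
        even number minus one.\<close>
      obtain c d where "b = e * c" "a - b = e * d"
        using dvd by (auto elim!: dvdE)
      hence "a = e * (c + d)" "e * c > 0" "e * d > 0"
        using assms(5,6) unfolding distrib_left by linarith+
      hence cd: "a = e * (c + d)" "c > 0" "d > 0"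
        by simp_all
      hence "c + d < p"
        using assms(7) by (simp add: mult.commute)
      hence "CARD('p) \<noteq> 2"
        using cd assms(1) by simp
      hence "odd q"
        using prime_odd_nat[OF prime_card[where 'a = 'p]] card_p_gt_1[where 'p = 'p] by (simp add: q)
      moreover have "q ^ b < q ^ a"
        using q1 assms(6) by simp
      ultimately have "odd n"
        using assms(5) by (simp add: n_def)
      thus ?thesis
        using g_poly_eval_0_odd[OF q \<open>CARD('p) \<noteq> 2\<close>] by (simp add: G_def True)
    next
      case False
      have "b < CARD('p) * e"
        using assms by simp
      thus ?thesis
        using g_poly_eval_iff[OF q assms(5,6) False]
          frob_sum_condition_of_dvd[OF q assms(5) _ dvd x] by (simp add: G_def n_def)
    qed
  qed
  have perm: "permutation_poly_on (GF (q ^ e)) (g_poly n q :: 'p mod_ring poly)"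
    if "\<forall>x\<in>GF (q ^ e). G x = - inverse x"
  proof -
    have "- inverse x \<in> GF (q ^ e)" if "x \<in> GF (q ^ e)" for x :: "'p mod_ring alg_closure"
      using GF_subfield(4,6)[OF qe(1)] that by blast
    \<comment> \<open>The map sending \<open>x\<close> to \<open>- inverse x\<close> is its own
      inverse on the field.\<close>
    hence "bij_betw G (GF (q ^ e)) (GF (q ^ e))"
      using that by (intro bij_betw_byWitness[of _ "\<lambda>x. - inverse x"]) auto
    thus ?thesis
      by (simp add: permutation_poly_on_def G_def)
  qed
  show ?thesis
    unfolding cong using G forward backward perm unfolding n_def by blast
qed

end
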